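(* Let $b\in\{0,1\}^{\mathbb{Z}}$. Then $$W(A_b)\subseteq \mathrm{conv}\bigl(W(A_{\mathbf 0})\cup W(A_{\mathbf 1})\bigr).$$
   Context: For a biinfinite sequence $b=(b_i)_{i\in\mathbb{Z}}\in\{0,1\}^{\mathbb{Z}}$, $A_b\colon \ell^2(\mathbb{Z})\to\ell^2(\mathbb{Z})$ (complex scalars) denotes the bounded tridiagonal operator $(A_bx)_k=b_{k-1}x_{k-1}+x_{k+1}$ for $k\in\mathbb{Z}$. $\mathbf 0$ and $\mathbf 1$ denote the constant biinfinite sequences with all entries $0$ and all entries $1$, respectively. The numerical range of an operator $A$ on $\ell^2(\mathbb{Z})$ is $W(A)=\{\langle Ax,x\rangle : x\in\ell^2(\mathbb{Z}),\ \|x\|=1\}$, where $\langle x,y\rangle=\sum_{k}x_k\overline{y_k}$. $\mathrm{conv}(S)$ is the convex hull of $S\subset\mathbb{C}$ (no closure taken). *)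

theory Defs
  imports "HOL-Analysis.Analysis"
begin

definition l2 :: "(int \<Rightarrow> complex) set" where
  "l2 = {x. (\<lambda>k. (cmod (x k))\<^sup>2) summable_on UNIV}"

definition l2_inner :: "(int \<Rightarrow> complex) \<Rightarrow> (int \<Rightarrow> complex) \<Rightarrow> complex" where
  "l2_inner x y = (\<Sum>\<^sub>\<infinity>k. x k * cnj (y k))"

definition l2_norm :: "(int \<Rightarrow> complex) \<Rightarrow> real" where
  "l2_norm x = sqrt (\<Sum>\<^sub>\<infinity>k. (cmod (x k))\<^sup>2)"

text \<open>Operators on \<open>l2\<close> are represented by maps on all sequences; only their
  restriction to \<open>l2\<close> matters.\<close>

definition numerical_range :: "((int \<Rightarrow> complex) \<Rightarrow> (int \<Rightarrow> complex)) \<Rightarrow> complex set" where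
  "numerical_range A = {l2_inner (A x) x | x. x \<in> l2 \<and> l2_norm x = 1}"

definition tridiag_op :: "(int \<Rightarrow> complex) \<Rightarrow> (int \<Rightarrow> complex) \<Rightarrow> (int \<Rightarrow> complex)" where
  "tridiag_op b x = (\<lambda>k. b (k - 1) * x (k - 1) + x (k + 1))"

text \<open>The infinite sums above default to \<open>0\<close> when they do not converge. The following
  facts show that this default is never used in the numerical range of \<^term>\<open>tridiag_op b\<close>.\<close>

lemma summable_on_l2_inner:
  assumes "x \<in> l2" "y \<in> l2"
  shows "(\<lambda>k. x k * cnj (y k)) summable_on UNIV"
proof -
  have "(\<lambda>k. (cmod (x k))\<^sup>2 + (cmod (y k))\<^sup>2) summable_on UNIV"
    using assms by (auto simp: l2_def intro: summable_on_add)
  moreover have "norm (x k * cnj (y k)) \<le> (cmod (x k))\<^sup>2 + (cmod (y k))\<^sup>2" for k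
  proof -
    have "0 \<le> (cmod (x k) - cmod (y k))\<^sup>2" by simp
    moreover have "0 \<le> cmod (x k) * cmod (y k)" by simp
    ultimately show ?thesis unfolding norm_mult complex_mod_cnj power2_diff by linarith
  qed
  ultimately have "(\<lambda>k. norm (x k * cnj (y k))) summable_on UNIV"
    by (rule summable_on_comparison_test) auto
  then show ?thesis by (rule abs_summable_summable)
qed

lemma l2_add:
  assumes "x \<in> l2" "y \<in> l2"
  shows "(\<lambda>k. x k + y k) \<in> l2"
proof -
  have "(\<lambda>k. 2 * ((cmod (x k))\<^sup>2 + (cmod (y k))\<^sup>2)) summable_on UNIV"
    using assms by (auto simp: l2_def intro!: summable_on_cmult_right summable_on_add)
  moreover have "(cmod (x k + y k))\<^sup>2 \<le> 2 * ((cmod (x k))\<^sup>2 + (cmod (y k))\<^sup>2)" for k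
  proof -
    have "(cmod (x k + y k))\<^sup>2 \<le> (cmod (x k) + cmod (y k))\<^sup>2"
      by (intro power_mono norm_triangle_ineq) auto
    moreover have "0 \<le> (cmod (x k) - cmod (y k))\<^sup>2" by simp
    ultimately show ?thesis unfolding power2_diff power2_sum by argo
  qed
  ultimately have "(\<lambda>k. (cmod (x k + y k))\<^sup>2) summable_on UNIV"
    by (rule summable_on_comparison_test) auto
  then show ?thesis by (simp add: l2_def)
qed

lemma l2_shift:
  assumes "x \<in> l2"
  shows "(\<lambda>k. x (k + m)) \<in> l2"
proof -
  have "bij_betw (\<lambda>k::int. k + m) UNIV UNIV"
    by (rule bij_betwI[where g = "\<lambda>k. k - m"]) auto
  from summable_on_reindex_bij_betw[OF this, of "\<lambda>k. (cmod (x k))\<^sup>2"] assms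
  show ?thesis by (simp add: l2_def)
qed

lemma tridiag_op_in_l2:
  assumes "range b \<subseteq> {0, 1}" "x \<in> l2"
  shows "tridiag_op b x \<in> l2"
proof -
  have le: "(cmod (b (k - 1) * x (k - 1)))\<^sup>2 \<le> (cmod (x (k - 1)))\<^sup>2" for k
  proof -
    have "b (k - 1) = 0 \<or> b (k - 1) = 1" using assms(1) by blast
    then show ?thesis by (elim disjE) simp_all
  qed
  have "(\<lambda>k. (cmod (x (k - 1)))\<^sup>2) summable_on UNIV"
    using l2_shift[OF assms(2), of "- 1"] by (simp add: l2_def)
  then have "(\<lambda>k. (cmod (b (k - 1) * x (k - 1)))\<^sup>2) summable_on UNIV"
    by (rule summable_on_comparison_test) (use le in simp_all)
  then have "(\<lambda>k. b (k - 1) * x (k - 1)) \<in> l2"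
    by (simp add: l2_def)
  from l2_add[OF this l2_shift[OF assms(2), of 1]] show ?thesis
    by (simp add: tridiag_op_def)
qed

end

theory Submission
  imports Defs
begin

text \<open>
  Everything about \<^term>\<open>tridiag_op b\<close> on \<open>x\<close> is read off from the \<^emph>\<open>bonds\<close>
  \<open>u\<^sub>k = x\<^bsub>k+1\<^esub> \<cdot> cnj x\<^sub>k\<close>: reindexing one of the two diagonals turns the quadratic form into
  \<open>\<Sum> (u\<^sub>k + b\<^sub>k \<cdot> cnj u\<^sub>k)\<close>. A bond with \<open>b\<^sub>k = 0\<close> contributes \<open>u\<^sub>k\<close>, a bond with \<open>b\<^sub>k = 1\<close>
  contributes the real number \<open>2 Re u\<^sub>k\<close>. So the value \<open>z\<close> of the form is \<open>U\<^sub>0 + 2 Re U\<^sub>1\<close>, where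
  \<open>U\<^sub>0\<close> and \<open>U\<^sub>1\<close> are the sums of the two kinds of bonds. With \<open>s\<close> and \<open>t\<close> for their masses
  \<open>\<Sum> \<bar>u\<^sub>k\<bar>\<close>, the triangle inequality gives \<open>\<bar>U\<^sub>0\<bar> \<le> s\<close> and \<open>\<bar>U\<^sub>1\<bar> \<le> t\<close>.

  For a unit vector the total mass satisfies \<open>s + t < 1\<close>, strictly, because equality in
  \<open>2\<bar>x\<^sub>k\<bar>\<bar>x\<^bsub>k+1\<^esub>\<bar> \<le> \<bar>x\<^sub>k\<bar>\<^sup>2 + \<bar>x\<^bsub>k+1\<^esub>\<bar>\<^sup>2\<close> for all \<open>k\<close> would force \<open>\<bar>x\<^sub>k\<bar>\<close> to be constant
  (lemma \<open>bond_mass_less_1\<close>). Splitting the slack \<open>1 - s - t\<close> evenly between \<open>s\<close> and \<open>t\<close> gives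
  positive weights that add up to \<open>1\<close>, and these exhibit \<open>z\<close> as a convex combination of a point of
  the open unit disk and a point of the open real interval \<open>(-2, 2)\<close>.

  The disk lies in the numerical range for \<open>b = 0\<close>, where the operator is the backward shift and a
  one-sided geometric unit vector of ratio \<open>w\<close> has bonds \<open>w \<bar>x\<^sub>k\<bar>\<^sup>2\<close>, which sum to \<open>w\<close>. The interval
  lies in the numerical range for \<open>b = 1\<close>, since the form for \<open>b = 1\<close> is twice the real part of the form for
  \<open>b = 0\<close>.
\<close>

definition bond :: "(int \<Rightarrow> complex) \<Rightarrow> int \<Rightarrow> complex" where
  "bond x k = x (k + 1) * cnj (x k)"

lemma has_sum_shift_int:
  fixes f :: "int \<Rightarrow> 'a::{comm_monoid_add, topological_space}"
  shows "((\<lambda>k. f (k + m)) has_sum s) UNIV \<longleftrightarrow> (f has_sum s) UNIV"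
proof (rule has_sum_reindex_bij_betw)
  show "bij_betw (\<lambda>k::int. k + m) UNIV UNIV"
    by (rule bij_betwI[where g = "\<lambda>k. k - m"]) auto
qed

lemma unit_vector_iff_has_sum:
  "x \<in> l2 \<and> l2_norm x = 1 \<longleftrightarrow> ((\<lambda>k. (cmod (x k))\<^sup>2) has_sum 1) UNIV"
  by (auto simp: l2_def l2_norm_def has_sum_infsum summable_on_def dest: infsumI)
    (metis has_sum_infsum summable_on_def)

text \<open>
  By reindexing, the arithmetic means of \<open>\<bar>x\<^sub>k\<bar>\<^sup>2\<close> and \<open>\<bar>x\<^bsub>k+1\<^esub>\<bar>\<^sup>2\<close> also sum to \<open>1\<close>, and they exceed
  \<open>\<bar>u\<^sub>k\<bar>\<close> by exactly \<open>(\<bar>x\<^sub>k\<bar> - \<bar>x\<^bsub>k+1\<^esub>\<bar>)\<^sup>2 / 2\<close>. These gaps cannot all vanish, since no nonzero sequence of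
  constant modulus is square summable over the integers. The strict inequality is what makes the
  convex hull suffice without a closure.
\<close>
lemma bond_mass_less_1:
  assumes "x \<in> l2" "l2_norm x = 1"
  shows "(\<lambda>k. cmod (bond x k)) summable_on UNIV" and "(\<Sum>\<^sub>\<infinity>k. cmod (bond x k)) < 1"
proof -
  define a where "a k = cmod (x k)" for k
  have a: "((\<lambda>k. (a k)\<^sup>2) has_sum 1) UNIV"
    using assms unit_vector_iff_has_sum unfolding a_def by blast
  then have "((\<lambda>k. (a (k + 1))\<^sup>2) has_sum 1) UNIV"
    using has_sum_shift_int[of "\<lambda>k. (a k)\<^sup>2" 1] by simp
  from has_sum_cmult_right[OF has_sum_add[OF a this], of "1/2"]
  have mean: "((\<lambda>k. 1/2 * ((a k)\<^sup>2 + (a (k + 1))\<^sup>2)) has_sum 1) UNIV"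
    by simp
  have gap: "1/2 * ((a k)\<^sup>2 + (a (k + 1))\<^sup>2) - cmod (bond x k) = 1/2 * (a k - a (k + 1))\<^sup>2" for k
    by (simp add: bond_def a_def norm_mult power2_eq_square field_simps)
  have le: "cmod (bond x k) \<le> 1/2 * ((a k)\<^sup>2 + (a (k + 1))\<^sup>2)" for k
    using gap[of k] zero_le_power2[of "a k - a (k + 1)"] by linarith
  show summable: "(\<lambda>k. cmod (bond x k)) summable_on UNIV"
    by (rule summable_on_comparison_test[OF has_sum_imp_summable[OF mean]]) (use le in auto)
  have "\<exists>k. a k \<noteq> a (k + 1)"
  proof (rule ccontr)
    assume "\<nexists>k. a k \<noteq> a (k + 1)"
    then have step: "a k = a (k + 1)" for k
      by blast
    have const: "a k = a 0" for k
    proof (induction k rule: int_induct[where k = 0])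
      case (step2 i)
      then show ?case using step[of "i - 1"] by simp
    qed (use step in auto)
    have "(\<lambda>k::int. (a 0)\<^sup>2) summable_on UNIV"
      using has_sum_imp_summable[OF a] const by (metis (no_types, lifting) summable_on_cong)
    then have "a 0 = 0"
      using infsum_diverge_constant[of "UNIV :: int set" "(a 0)\<^sup>2"] infinite_UNIV_int by auto
    then have "((\<lambda>k::int. 0::real) has_sum 1) UNIV"
      using a const by simp
    then show False
      using infsumI by fastforce
  qed
  then obtain k where "a k \<noteq> a (k + 1)" by blast
  then have "cmod (bond x k) < 1/2 * ((a k)\<^sup>2 + (a (k + 1))\<^sup>2)"
    using gap[of k] zero_less_power2[of "a k - a (k + 1)"] by linarith
  then show "(\<Sum>\<^sub>\<infinity>k. cmod (bond x k)) < 1"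
    using has_sum_strict_mono[OF has_sum_infsum[OF summable] mean le] by blast
qed

text \<open>
  The lower diagonal contributes \<open>b\<^bsub>k-1\<^esub> x\<^bsub>k-1\<^esub> \<cdot> cnj x\<^sub>k = b\<^bsub>k-1\<^esub> \<cdot> cnj u\<^bsub>k-1\<^esub>\<close> in row \<open>k\<close>. Absolute
  summability allows moving this term to row \<open>k - 1\<close>, so that each bond meets only its own \<open>b\<^sub>k\<close>.
\<close>
lemma has_sum_quadratic_form:
  assumes "range b \<subseteq> {0, 1}" "x \<in> l2" "l2_norm x = 1"
  shows "((\<lambda>k. bond x k + b k * cnj (bond x k)) has_sum l2_inner (tridiag_op b x) x) UNIV"
proof -
  have abs: "(\<lambda>k. cmod (bond x k)) summable_on UNIV"
    using assms bond_mass_less_1 by blast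
  then have bond: "bond x summable_on UNIV"
    by (rule abs_summable_summable)
  have b: "cmod (b k) \<le> 1" for k
  proof -
    have "b k = 0 \<or> b k = 1"
      using assms(1) by blast
    then show ?thesis
      by (elim disjE) simp_all
  qed
  have "(\<lambda>k. cmod (b k * cnj (bond x k))) summable_on UNIV"
  proof (rule summable_on_comparison_test[OF abs])
    show "cmod (b k * cnj (bond x k)) \<le> cmod (bond x k)" for k
      using mult_right_mono[OF b[of k] norm_ge_zero[of "bond x k"]] by (simp add: norm_mult)
  qed simp
  then have "(\<lambda>k. b k * cnj (bond x k)) summable_on UNIV"
    by (rule abs_summable_summable)
  then obtain s where s: "((\<lambda>k. b k * cnj (bond x k)) has_sum s) UNIV"
    unfolding summable_on_def by blast
  then have "((\<lambda>k. b (k - 1) * cnj (bond x (k - 1))) has_sum s) UNIV"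
    using has_sum_shift_int[of "\<lambda>k. b k * cnj (bond x k)" "-1"] by simp
  from has_sum_add[OF has_sum_infsum[OF bond] this]
  have "((\<lambda>k. tridiag_op b x k * cnj (x k)) has_sum (infsum (bond x) UNIV + s)) UNIV"
    by (simp add: tridiag_op_def bond_def algebra_simps)
  then have "l2_inner (tridiag_op b x) x = infsum (bond x) UNIV + s"
    unfolding l2_inner_def by (rule infsumI)
  then show ?thesis
    using has_sum_add[OF has_sum_infsum[OF bond] s] by simp
qed

text \<open>
  The geometric sequence \<open>c z\<^sup>k\<close> on \<open>k \<ge> 0\<close> is an eigenvector of the backward shift up to the
  coordinate \<open>k = -1\<close>, where \<open>x\<^sub>k\<close> vanishes anyway; hence \<open>u\<^sub>k = z \<bar>x\<^sub>k\<bar>\<^sup>2\<close> for every \<open>k\<close>. The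
  prescribed value is stated through the bonds, so that it yields points of the numerical range for
  \<open>b = 0\<close> and for \<open>b = 1\<close>.
\<close>
lemma unit_vector_with_bond_sum:
  assumes "cmod z < 1"
  obtains x where "x \<in> l2" "l2_norm x = 1" "(bond x has_sum z) UNIV"
proof -
  define c where "c = sqrt (1 - (cmod z)\<^sup>2)"
  define x where "x k = (if k < 0 then 0 else complex_of_real c * z ^ nat k)" for k :: int
  have lt: "(cmod z)\<^sup>2 < 1"
    using assms by (simp add: power_less_one_iff)
  then have c2: "c\<^sup>2 = 1 - (cmod z)\<^sup>2" and "c\<^sup>2 \<noteq> 0"
    by (simp_all add: c_def)
  have "(\<lambda>n. c\<^sup>2 * ((cmod z)\<^sup>2) ^ n) sums (c\<^sup>2 * (1 / (1 - (cmod z)\<^sup>2)))"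
    using lt by (intro sums_mult geometric_sums) simp
  then have "(\<lambda>n. c\<^sup>2 * ((cmod z)\<^sup>2) ^ n) sums 1"
    using c2 \<open>c\<^sup>2 \<noteq> 0\<close> by simp
  then have geo: "((\<lambda>n. c\<^sup>2 * ((cmod z)\<^sup>2) ^ n) has_sum 1) UNIV"
    by (rule sums_nonneg_imp_has_sum) simp
  have "(\<lambda>k. (cmod (x k))\<^sup>2) \<circ> int = (\<lambda>n. c\<^sup>2 * ((cmod z)\<^sup>2) ^ n)"
    by (auto simp: fun_eq_iff x_def norm_mult norm_power power_mult_distrib
        simp flip: power_mult) (simp add: mult.commute)
  then have "((\<lambda>k. (cmod (x k))\<^sup>2) has_sum 1) (range int)"
    using geo by (subst has_sum_reindex) auto
  moreover have "x k = 0" if "k \<notin> range int" for k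
    using that by (metis x_def not_less rangeI nonneg_int_cases)
  ultimately have unit: "((\<lambda>k. (cmod (x k))\<^sup>2) has_sum 1) UNIV"
    by (subst has_sum_cong_neutral[of "range int"]) auto
  have "bond x k = z * complex_of_real ((cmod (x k))\<^sup>2)" for k
  proof (cases "k < 0")
    case True
    then show ?thesis by (simp add: bond_def x_def)
  next
    case False
    then have "x (k + 1) = z * x k"
      by (simp add: x_def nat_add_distrib)
    then show ?thesis
      by (simp add: bond_def mult.assoc flip: complex_norm_square)
  qed
  moreover have "((\<lambda>k. z * complex_of_real ((cmod (x k))\<^sup>2)) has_sum z * complex_of_real 1) UNIV"
    by (intro has_sum_cmult_right has_sum_of_real unit)
  ultimately have "(bond x has_sum z) UNIV"
    by (metis (no_types, lifting) has_sum_cong mult.right_neutral of_real_1)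
  then show ?thesis
    using that unit unit_vector_iff_has_sum by blast
qed

lemma unit_disk_subset_numerical_range_0:
  "ball 0 1 \<subseteq> numerical_range (tridiag_op (\<lambda>_. 0))"
proof
  fix z :: complex
  assume "z \<in> ball 0 1"
  then obtain x where x: "x \<in> l2" "l2_norm x = 1" "(bond x has_sum z) UNIV"
    using unit_vector_with_bond_sum by auto
  then have "(bond x has_sum l2_inner (tridiag_op (\<lambda>_. 0) x) x) UNIV"
    using has_sum_quadratic_form[of "\<lambda>_. 0" x] by simp
  from has_sum_unique[OF x(3) this] show "z \<in> numerical_range (tridiag_op (\<lambda>_. 0))"
    using x(1,2) unfolding numerical_range_def by blast
qed

lemma interval_subset_numerical_range_1:
  "complex_of_real ` {-2<..<2} \<subseteq> numerical_range (tridiag_op (\<lambda>_. 1))"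
proof
  fix z :: complex
  assume "z \<in> complex_of_real ` {-2<..<2}"
  then obtain p where z: "z = complex_of_real p" and p: "p \<in> {-2<..<2}"
    by blast
  have "cmod (complex_of_real (p / 2)) < 1"
    unfolding norm_of_real using p by (simp add: abs_less_iff)
  then obtain x where x: "x \<in> l2" "l2_norm x = 1" "(bond x has_sum complex_of_real (p / 2)) UNIV"
    by (rule unit_vector_with_bond_sum)
  have "((\<lambda>k. cnj (bond x k)) has_sum cnj (complex_of_real (p / 2))) UNIV"
    using x(3) by (rule has_sum_cnj_iff[THEN iffD2])
  from has_sum_add[OF x(3) this]
  have "((\<lambda>k. bond x k + cnj (bond x k)) has_sum z) UNIV"
    by (simp add: z)
  moreover have "((\<lambda>k. bond x k + cnj (bond x k)) has_sum l2_inner (tridiag_op (\<lambda>_. 1) x) x) UNIV"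
    using has_sum_quadratic_form[of "\<lambda>_. 1" x] x by simp
  ultimately have "z = l2_inner (tridiag_op (\<lambda>_. 1) x) x"
    by (rule has_sum_unique)
  then show "z \<in> numerical_range (tridiag_op (\<lambda>_. 1))"
    using x(1,2) unfolding numerical_range_def by blast
qed

theorem theorem2p5:
  fixes b :: "int \<Rightarrow> complex"
  assumes "range b \<subseteq> {0, 1}"
  shows "numerical_range (tridiag_op b) \<subseteq>
    convex hull (numerical_range (tridiag_op (\<lambda>_. 0)) \<union> numerical_range (tridiag_op (\<lambda>_. 1)))"
proof
  fix z
  assume "z \<in> numerical_range (tridiag_op b)"
  then obtain x where x: "x \<in> l2" "l2_norm x = 1" and z: "z = l2_inner (tridiag_op b x) x"
    unfolding numerical_range_def by blast
  let ?u = "bond x"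
  define B0 B1 where "B0 = {k. b k = 0}" and "B1 = {k. b k = 1}"
  have part: "B0 \<union> B1 = UNIV" "B0 \<inter> B1 = {}"
    using assms unfolding B0_def B1_def by (blast, simp add: disjoint_iff)
  have abs: "(\<lambda>k. cmod (?u k)) summable_on A" for A
    by (rule summable_on_subset_banach[OF bond_mass_less_1(1)[OF x] subset_UNIV])
  then have sum: "?u summable_on A" for A
    by (rule abs_summable_summable)
  define s t where "s = (\<Sum>\<^sub>\<infinity>k\<in>B0. cmod (?u k))" and "t = (\<Sum>\<^sub>\<infinity>k\<in>B1. cmod (?u k))"
  have "s \<ge> 0" "t \<ge> 0"
    by (simp_all add: s_def t_def infsum_nonneg)
  have "s + t = (\<Sum>\<^sub>\<infinity>k. cmod (?u k))"
    using infsum_Un_disjoint[OF abs abs part(2)] by (simp add: s_def t_def part(1))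
  then have "s + t < 1"
    using bond_mass_less_1(2)[OF x] by simp
  define U0 U1 where "U0 = infsum ?u B0" and "U1 = infsum ?u B1"
  have U0: "cmod U0 \<le> s" and U1: "cmod U1 \<le> t"
    unfolding U0_def U1_def s_def t_def using abs by (simp_all add: norm_infsum_bound)
  have "((\<lambda>k. ?u k + b k * cnj (?u k)) has_sum U0) B0"
    using has_sum_infsum[OF sum[of B0]] unfolding U0_def
    by (rule has_sum_cong[THEN iffD1, rotated]) (simp add: B0_def)
  moreover have "((\<lambda>k. ?u k + cnj (?u k)) has_sum (U1 + cnj U1)) B1"
    unfolding U1_def by (intro has_sum_add has_sum_cnj_iff[THEN iffD2] has_sum_infsum sum)
  then have "((\<lambda>k. ?u k + b k * cnj (?u k)) has_sum (U1 + cnj U1)) B1"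
    by (rule has_sum_cong[THEN iffD1, rotated]) (simp add: B1_def)
  ultimately have "((\<lambda>k. ?u k + b k * cnj (?u k)) has_sum (U0 + (U1 + cnj U1))) UNIV"
    by (rule has_sum_Un_disjoint[OF _ _ part(2), unfolded part(1)])
  then have z_eq: "z = U0 + complex_of_real (2 * Re U1)"
    unfolding z complex_add_cnj by (rule has_sum_unique[OF has_sum_quadratic_form[OF assms x]])
  \<comment> \<open>Half of the slack goes to each weight, so both are positive and strictly exceed the masses.\<close>
  define lam mu where "lam = s + (1 - (s + t)) / 2" and "mu = t + (1 - (s + t)) / 2"
  have weights: "lam + mu = 1" "s < lam" "t < mu"
    using \<open>s + t < 1\<close> by (simp_all add: lam_def mu_def field_simps)
  then have pos: "0 < lam" "0 < mu"
    using \<open>s \<ge> 0\<close> \<open>t \<ge> 0\<close> by linarith+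
  have "U0 / lam \<in> ball 0 1"
    using U0 weights pos by (simp add: norm_divide)
  then have d: "U0 / lam \<in> numerical_range (tridiag_op (\<lambda>_. 0))"
    using unit_disk_subset_numerical_range_0 by blast
  have "\<bar>Re U1\<bar> < mu"
    using abs_Re_le_cmod[of U1] U1 weights by linarith
  then have "2 * Re U1 / mu \<in> {-2<..<2}"
    using pos by (simp add: field_simps abs_less_iff)
  then have p: "complex_of_real (2 * Re U1 / mu) \<in> numerical_range (tridiag_op (\<lambda>_. 1))"
    using interval_subset_numerical_range_1 by blast
  have "z = lam *\<^sub>R (U0 / lam) + mu *\<^sub>R complex_of_real (2 * Re U1 / mu)"
    using pos by (simp add: z_eq scaleR_conv_of_real)
  also have "\<dots> \<in> convex hull
      (numerical_range (tridiag_op (\<lambda>_. 0)) \<union> numerical_range (tridiag_op (\<lambda>_. 1)))"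
    using d p pos weights(1) by (intro convexD[OF convex_convex_hull] hull_inc) auto
  finally show "z \<in> convex hull
      (numerical_range (tridiag_op (\<lambda>_. 0)) \<union> numerical_range (tridiag_op (\<lambda>_. 1)))" .
qed

end
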